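(* Let $n_c,n_s\ge 1$ and $n=n_c+n_s$. Let $A,X\in\mathbb{R}^{n\times n}$ be symmetric positive definite, let $R\in\mathbb{R}^{n_c\times n}$ be such that there exists $P\in\mathbb{R}^{n\times n_c}$ with $RP=I_{n_c}$, and let $S\in\mathbb{R}^{n\times n_s}$ have full column rank with $RS=0$. Then, with the sets $\mathbb{P}_\star,\mathbb{P}_0,\mathbb{P}_1,\mathbb{P}_2$ of matrices $P\in\mathbb{R}^{n\times n_c}$ satisfying $RP=I_{n_c}$ defined in the context, $$\mathbb{P}_0\subseteq\mathbb{P}_2=\mathbb{P}_\star\subseteq\mathbb{P}_1 .$$
   Context: All matrices are real; $(\cdot,\cdot)$ is the Euclidean inner product; $\lambda_{\min}(\cdot)$ is the smallest eigenvalue; powers $(\cdot)^{-1/2}$ of symmetric positive definite matrices are the symmetric positive definite ones. $A,X,R,S$ are fixed, and $P$ always ranges over the matrices in $\mathbb{R}^{n\times n_c}$ with $RP=I_{n_c}$. For $Q=PR$ and $\mathbf{e}\in\mathbb{R}^n\setminus\{0\}$ put $$\mu_X(Q,\mathbf{e})=\frac{\big(X(I-Q)\mathbf{e},(I-Q)\mathbf{e}\big)}{(A\mathbf{e},\mathbf{e})},\qquad \mu_X^\star=\min_{P}\max_{\mathbf{e}\ne0}\mu_X(PR,\mathbf{e}).$$ The set of ideal interpolations is $\mathbb{P}_\star=\{P:\max_{\mathbf{e}\neq0}\mu_X(PR,\mathbf{e})=\mu_X^\star\}$. Define $$A_X=(S^TXS)^{-1/2}S^TAS(S^TXS)^{-1/2},$$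 and, depending on $P$, $$B_X=(S^TXS)^{-1/2}\big(S^TAS-S^TAP(P^TAP)^{-1}P^TAS\big)(S^TXS)^{-1/2}.$$ Then $$\mathbb{P}_0=\{P:P^TAS=0\},$$ $$\mathbb{P}_1=\Big\{P:\operatorname{null}\big(P^TAS(S^TXS)^{-1/2}\big)\cap\{\mathbf{v}\in\mathbb{R}^{n_s}\setminus\{0\}:A_X\mathbf{v}=\lambda_{\min}(A_X)\mathbf{v}\}\neq\varnothing\Big\},$$ $$\mathbb{P}_2=\Big\{P:\operatorname{null}\big(P^TAS(S^TXS)^{-1/2}\big)\cap\{\mathbf{v}\in\mathbb{R}^{n_s}\setminus\{0\}:B_X\mathbf{v}=\lambda_{\min}(B_X)\mathbf{v}\}\neq\varnothing\Big\}.$$ *)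

theory Defs
  imports "HOL-Analysis.Analysis"
begin

definition spd :: "real^'n^'n \<Rightarrow> bool" where
  "spd M \<longleftrightarrow> transpose M = M \<and> (\<forall>x. x \<noteq> 0 \<longrightarrow> (M *v x) \<bullet> x > 0)"

text \<open>The power \<open>M\<^sup>-\<^sup>1\<^sup>/\<^sup>2\<close>, meaningful for symmetric positive definite \<open>M\<close>, where the
  symmetric positive definite square root of the inverse exists and is unique.\<close>

definition inv_sqrt :: "real^'n^'n \<Rightarrow> real^'n^'n" where
  "inv_sqrt M = (THE N. spd N \<and> N ** N = matrix_inv M)"

definition eigenvecs :: "real^'n^'n \<Rightarrow> real \<Rightarrow> (real^'n) set" where
  "eigenvecs M l = {v. v \<noteq> 0 \<and> M *v v = l *\<^sub>R v}"

text \<open>The smallest (real) eigenvalue; it exists whenever \<open>M\<close> is symmetric.\<close>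

definition lambda_min :: "real^'n^'n \<Rightarrow> real" where
  "lambda_min M = (LEAST l. eigenvecs M l \<noteq> {})"

definition null_space :: "real^'n^'m \<Rightarrow> (real^'n) set" where
  "null_space M = {v. M *v v = 0}"

definition interps :: "real^'n^'c \<Rightarrow> (real^'c^'n) set" where
  "interps R = {P. R ** P = mat 1}"

definition mu :: "real^'n^'n \<Rightarrow> real^'n^'n \<Rightarrow> real^'n^'n \<Rightarrow> real^'n \<Rightarrow> real" where
  "mu A X Q e = ((X ** (mat 1 - Q)) *v e) \<bullet> ((mat 1 - Q) *v e) / ((A *v e) \<bullet> e)"

text \<open>The maximum and the minimum below are genuine ones (\<open>GREATEST\<close>, \<open>LEAST\<close>), not a
  supremum and an infimum: for symmetric positive definite \<open>A\<close> and \<open>X\<close> both are attained.\<close>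

definition mu_max :: "real^'n^'n \<Rightarrow> real^'n^'n \<Rightarrow> real^'n^'n \<Rightarrow> real" where
  "mu_max A X Q = (GREATEST m. \<exists>e. e \<noteq> 0 \<and> m = mu A X Q e)"

definition mu_star :: "real^'n^'n \<Rightarrow> real^'n^'n \<Rightarrow> real^'n^'c \<Rightarrow> real" where
  "mu_star A X R = (LEAST m. \<exists>P \<in> interps R. m = mu_max A X (P ** R))"

definition P_star :: "real^'n^'n \<Rightarrow> real^'n^'n \<Rightarrow> real^'n^'c \<Rightarrow> (real^'c^'n) set" where
  "P_star A X R = {P \<in> interps R. mu_max A X (P ** R) = mu_star A X R}"

definition A_X :: "real^'n^'n \<Rightarrow> real^'n^'n \<Rightarrow> real^'s^'n \<Rightarrow> real^'s^'s" where
  "A_X A X S =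
     inv_sqrt (transpose S ** X ** S) ** (transpose S ** A ** S) **
     inv_sqrt (transpose S ** X ** S)"

definition B_X :: "real^'n^'n \<Rightarrow> real^'n^'n \<Rightarrow> real^'s^'n \<Rightarrow> real^'c^'n \<Rightarrow> real^'s^'s" where
  "B_X A X S P =
     inv_sqrt (transpose S ** X ** S) **
     (transpose S ** A ** S -
      transpose S ** A ** P ** matrix_inv (transpose P ** A ** P) ** transpose P ** A ** S) **
     inv_sqrt (transpose S ** X ** S)"

definition P_0 :: "real^'n^'n \<Rightarrow> real^'n^'c \<Rightarrow> real^'s^'n \<Rightarrow> (real^'c^'n) set" where
  "P_0 A R S = {P \<in> interps R. transpose P ** A ** S = 0}"

definition P_1 ::
    "real^'n^'n \<Rightarrow> real^'n^'n \<Rightarrow> real^'n^'c \<Rightarrow> real^'s^'n \<Rightarrow> (real^'c^'n) set" where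
  "P_1 A X R S = {P \<in> interps R.
     null_space (transpose P ** A ** S ** inv_sqrt (transpose S ** X ** S)) \<inter>
     eigenvecs (A_X A X S) (lambda_min (A_X A X S)) \<noteq> {}}"

definition P_2 ::
    "real^'n^'n \<Rightarrow> real^'n^'n \<Rightarrow> real^'n^'c \<Rightarrow> real^'s^'n \<Rightarrow> (real^'c^'n) set" where
  "P_2 A X R S = {P \<in> interps R.
     null_space (transpose P ** A ** S ** inv_sqrt (transpose S ** X ** S)) \<inter>
     eigenvecs (B_X A X S P) (lambda_min (B_X A X S P)) \<noteq> {}}"

end

theory Submission
  imports Defs
begin

text \<open>Every \<open>e\<close> is uniquely \<open>P y + S z\<close>, and then \<open>(I - P R) e = S z\<close>. Minimising \<open>(A e, e)\<close> over \<open>y\<close>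
  replaces \<open>S\<^sup>T A S\<close> by its Schur complement, so the maximum of \<open>\<mu>\<close> is \<open>1 / \<lambda>\<^sub>m\<^sub>i\<^sub>n(B\<^sub>X)\<close>. Since
  \<open>B\<^sub>X \<le> A\<^sub>X\<close>, with equality for \<open>P = A\<inverse> R\<^sup>T (R A\<inverse> R\<^sup>T)\<inverse>\<close>, the interpolation \<open>P\<close> is ideal iff
  \<open>\<lambda>\<^sub>m\<^sub>i\<^sub>n(B\<^sub>X) = \<lambda>\<^sub>m\<^sub>i\<^sub>n(A\<^sub>X)\<close>. In that case a minimal eigenvector \<open>v\<close> of \<open>A\<^sub>X\<close> satisfies
  \<open>(A\<^sub>X v, v) = (B\<^sub>X v, v)\<close>, which forces \<open>P\<^sup>T A S (S\<^sup>T X S)\<^sup>-\<^sup>1\<^sup>/\<^sup>2 v = 0\<close>; conversely, \<open>A\<^sub>X\<close> and \<open>B\<^sub>X\<close>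
  agree on that null space.\<close>

section \<open>Spectral theory of symmetric matrices\<close>

lemma transpose_dot: "(transpose M *v x) \<bullet> y = x \<bullet> (M *v y)" for M :: "real^'n^'m"
  by (simp add: transpose_matrix_vector dot_lmul_matrix)

lemma symmetric_dot:
  fixes M :: "real^'n^'n"
  assumes "transpose M = M"
  shows "(M *v x) \<bullet> y = x \<bullet> (M *v y)"
  using transpose_dot[of M x y] assms by simp

lemma symmetric_dotI:
  fixes M :: "real^'n^'n"
  assumes "\<And>x y. (M *v x) \<bullet> y = x \<bullet> (M *v y)"
  shows "transpose M = M"
proof -
  have "(transpose M *v x) \<bullet> y = (M *v x) \<bullet> y" for x y
    by (simp add: transpose_dot assms del: transpose_matrix_vector)
  then have "transpose M *v x = M *v x" for x
    by (metis vector_eq_rdot)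
  then show ?thesis
    by (simp add: matrix_eq)
qed

text \<open>First-order condition: the quadratic attains its minimum 0 at \<open>t = 0\<close>, so
  its slope there vanishes.\<close>

lemma nonneg_quadratic_imp_linear_zero:
  fixes a b :: real
  assumes "\<And>t. 0 \<le> 2 * t * a + t\<^sup>2 * b"
  shows "a = 0"
proof (rule ccontr)
  assume a: "a \<noteq> 0"
  \<comment> \<open>Being positive and larger than \<open>b\<close>, this \<open>d\<close> makes the
    linear term outweigh the square at \<open>t = - a / d\<close>.\<close>
  define d where "d = \<bar>b\<bar> + 1"
  have d: "d > 0" "b < d" by (auto simp: d_def)
  have "0 \<le> 2 * (- a / d) * a + (- a / d)\<^sup>2 * b" by (rule assms)
  also have "\<dots> = (a / d)\<^sup>2 * (b - 2 * d)"
    using d by (simp add: field_simps power2_eq_square)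
  also have "\<dots> < 0"
    using a d by (intro mult_pos_neg) auto
  finally show False by simp
qed

text \<open>The minimiser of the Rayleigh quotient over the unit sphere of \<open>V\<close> is an eigenvector, because
  the quadratic form \<open>f x \<bullet> x - m (x \<bullet> x)\<close> is nonnegative and vanishes there.\<close>

lemma selfadjoint_min_eigenvector:
  fixes f :: "'a::euclidean_space \<Rightarrow> 'a"
  assumes V: "subspace V" "V \<noteq> {0}" and f: "linear f" "f ` V \<subseteq> V"
    and sa: "\<And>x y. f x \<bullet> y = x \<bullet> f y"
  obtains v m where "v \<in> V" "norm v = 1" "f v = m *\<^sub>R v" "\<And>x. x \<in> V \<Longrightarrow> m * (x \<bullet> x) \<le> f x \<bullet> x"
proof -
  let ?K = "sphere 0 1 \<inter> V"
  have cK: "compact ?K"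
    using closed_subspace[OF V(1)] by (intro compact_Int_closed) auto
  obtain w where w: "w \<in> V" "w \<noteq> 0" using V subspace_0 by blast
  then have "(1 / norm w) *\<^sub>R w \<in> ?K"
    using V(1) by (auto simp: subspace_scale)
  then have ne: "?K \<noteq> {}" by blast
  have "continuous_on ?K (\<lambda>x. f x \<bullet> x)"
    using f(1) by (intro continuous_intros linear_continuous_on) (simp add: linear_conv_bounded_linear)
  from continuous_attains_inf[OF cK ne this]
  obtain v where v: "v \<in> ?K" and min: "\<And>x. x \<in> ?K \<Longrightarrow> f v \<bullet> v \<le> f x \<bullet> x" by blast
  define m where "m = f v \<bullet> v"
  have vv: "v \<bullet> v = 1" using v by (simp add: dot_square_norm)
  have bound: "m * (x \<bullet> x) \<le> f x \<bullet> x" if "x \<in> V" for x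
  proof (cases "x = 0")
    case False
    let ?u = "(1 / norm x) *\<^sub>R x"
    have "?u \<in> ?K" using that False V(1) by (auto simp: subspace_scale)
    from min[OF this] have "m \<le> f ?u \<bullet> ?u" by (simp add: m_def)
    also have "\<dots> = (f x \<bullet> x) / (x \<bullet> x)"
      by (simp add: linear_scale[OF f(1)] dot_square_norm power2_eq_square)
    finally show ?thesis using False by (simp add: field_simps)
  qed (simp add: linear_0[OF f(1)])
  \<comment> \<open>The residual of the eigenvalue equation lies in \<open>V\<close>, so
    \<open>v\<close> may be varied along it; the linear coefficient of that variation is
    \<open>2 * (w \<bullet> w)\<close>.\<close>
  define w where "w = f v - m *\<^sub>R v"
  have wV: "w \<in> V"
    using v f(2) V(1) by (auto simp: w_def intro!: subspace_diff subspace_scale)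
  have "0 \<le> 2 * t * (w \<bullet> w) + t\<^sup>2 * (f w \<bullet> w - m * (w \<bullet> w))" for t
  proof -
    have "v + t *\<^sub>R w \<in> V" using v wV V(1) by (auto intro!: subspace_add subspace_scale)
    from bound[OF this]
    have "0 \<le> f (v + t *\<^sub>R w) \<bullet> (v + t *\<^sub>R w) - m * ((v + t *\<^sub>R w) \<bullet> (v + t *\<^sub>R w))" by simp
    also have "\<dots> = (f v \<bullet> v - m * (v \<bullet> v)) + 2 * t * (f v \<bullet> w - m * (v \<bullet> w))
        + t\<^sup>2 * (f w \<bullet> w - m * (w \<bullet> w))"
      by (simp add: linear_add[OF f(1)] linear_scale[OF f(1)] inner_add sa[of w v]
          inner_commute[of w v] inner_commute[of w "f v"] algebra_simps power2_eq_square)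
    also have "f v \<bullet> v - m * (v \<bullet> v) = 0" by (simp add: vv m_def)
    also have "f v \<bullet> w - m * (v \<bullet> w) = w \<bullet> w" by (simp add: w_def inner_diff_left)
    finally show ?thesis by simp
  qed
  then have "w \<bullet> w = 0" by (rule nonneg_quadratic_imp_linear_zero)
  then have "f v = m *\<^sub>R v" by (simp add: w_def)
  with v bound show ?thesis by (intro that) auto
qed

text \<open>Induction on the dimension: split off one unit eigenvector and continue in its
  orthogonal complement within \<open>V\<close>, which self-adjointness keeps invariant.\<close>

lemma selfadjoint_eigenbasis:
  fixes f :: "'a::euclidean_space \<Rightarrow> 'a"
  assumes "linear f" and sa: "\<And>x y. f x \<bullet> y = x \<bullet> f y"
    and "subspace V" "f ` V \<subseteq> V"
  shows "\<exists>B. pairwise orthogonal B \<and> (\<forall>b\<in>B. norm b = 1 \<and> (\<exists>m. f b = m *\<^sub>R b)) \<and> span B = V"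
  using assms(3-)
proof (induction "dim V" arbitrary: V rule: less_induct)
  case less
  show ?case
  proof (cases "V = {0}")
    case True
    then show ?thesis by (intro exI[of _ "{}"]) auto
  next
    case False
    obtain v m where v: "v \<in> V" "norm v = 1" "f v = m *\<^sub>R v"
      using selfadjoint_min_eigenvector[OF less.prems(1) False \<open>linear f\<close> less.prems(2) sa] by metis
    have vv: "v \<bullet> v = 1" using v by (simp add: dot_square_norm)
    define W where "W = {x \<in> V. v \<bullet> x = 0}"
    have subW: "subspace W"
      using less.prems(1) by (auto simp: W_def subspace_def inner_add_right)
    have fW: "f ` W \<subseteq> W"
      using less.prems(2) v(3) by (auto simp: W_def sa[symmetric])
    have "v \<notin> W" "W \<subseteq> V" using vv by (auto simp: W_def)
    then have "W \<subset> V" using v by blast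
    then have "dim W < dim V"
      using subW less.prems(1) by (metis dim_psubset span_eq_iff)
    from less.hyps[OF this subW fW] obtain B where
      B: "pairwise orthogonal B" "\<forall>b\<in>B. norm b = 1 \<and> (\<exists>m. f b = m *\<^sub>R b)" "span B = W" by blast
    have BW: "B \<subseteq> W" using B(3) span_superset by blast
    have "pairwise orthogonal (insert v B)"
      using B(1) BW by (auto simp: pairwise_insert W_def orthogonal_def inner_commute)
    moreover have "span (insert v B) = V"
    proof
      show "span (insert v B) \<subseteq> V"
        using v BW less.prems(1) by (intro span_minimal) (auto simp: W_def)
      show "V \<subseteq> span (insert v B)"
      proof
        fix x assume "x \<in> V"
        then have "x - (v \<bullet> x) *\<^sub>R v \<in> W"
          using v less.prems(1) by (auto simp: W_def vv inner_diff_right subspace_diff subspace_scale)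
        then show "x \<in> span (insert v B)"
          unfolding B(3)[symmetric] span_insert by blast
      qed
    qed
    ultimately show ?thesis using B(2) v by (intro exI[of _ "insert v B"]) auto
  qed
qed

text \<open>The Rayleigh minimum is an eigenvalue, and its bound tested at any eigenvector shows
  that no eigenvalue is smaller. Later arguments use \<open>lambda_min\<close> only through these
  two facts.\<close>

lemma lambda_min_symmetric:
  fixes M :: "real^'n^'n"
  assumes "transpose M = M"
  shows "eigenvecs M (lambda_min M) \<noteq> {}" "lambda_min M * (x \<bullet> x) \<le> (M *v x) \<bullet> x"
proof -
  have ne: "(UNIV :: (real^'n) set) \<noteq> {0}"
    using zero_neq_one by blast
  obtain v m where v: "norm v = 1" "M *v v = m *\<^sub>R v" "\<And>x. m * (x \<bullet> x) \<le> (M *v x) \<bullet> x"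
    using selfadjoint_min_eigenvector[of UNIV "(*v) M"] symmetric_dot[OF assms] ne
    by (metis UNIV_I matrix_vector_mul_linear subset_UNIV subspace_UNIV)
  then have v0: "v \<noteq> 0" by auto
  have "lambda_min M = m"
    unfolding lambda_min_def
  proof (rule Least_equality)
    show "eigenvecs M m \<noteq> {}" using v(2) v0 by (auto simp: eigenvecs_def)
    fix l assume "eigenvecs M l \<noteq> {}"
    then obtain w where "w \<noteq> 0" "M *v w = l *\<^sub>R w" by (auto simp: eigenvecs_def)
    with v(3)[of w] show "m \<le> l" by simp
  qed
  with v v0 show "eigenvecs M (lambda_min M) \<noteq> {}" "lambda_min M * (x \<bullet> x) \<le> (M *v x) \<bullet> x"
    by (auto simp: eigenvecs_def)
qed

section \<open>Positive definite matrices\<close>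

lemma spd_pos: "spd M \<Longrightarrow> x \<noteq> 0 \<Longrightarrow> (M *v x) \<bullet> x > 0"
  by (simp add: spd_def)

lemma spd_nonneg: "spd M \<Longrightarrow> (M *v x) \<bullet> x \<ge> 0"
  by (cases "x = 0") (auto dest: spd_pos less_imp_le)

lemma spd_symmetric: "spd M \<Longrightarrow> transpose M = M"
  by (simp add: spd_def)

lemma spd_ker: "spd M \<Longrightarrow> M *v x = 0 \<Longrightarrow> x = 0"
  using spd_pos by fastforce

lemma spd_matrix_inv:
  assumes "spd M"
  shows "M ** matrix_inv M = mat 1" "matrix_inv M ** M = mat 1"
proof -
  have "invertible M"
    using spd_ker[OF assms] matrix_left_invertible_ker invertible_left_inverse by metis
  then show "M ** matrix_inv M = mat 1" "matrix_inv M ** M = mat 1"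
    unfolding matrix_inv_def invertible_def by (metis (mono_tags, lifting) someI_ex)+
qed

lemma spd_matrix_inv_vec:
  assumes "spd M"
  shows "M *v (matrix_inv M *v x) = x" "matrix_inv M *v (M *v x) = x"
  by (simp_all add: matrix_vector_mul_assoc spd_matrix_inv[OF assms])

lemma spd_inv:
  assumes "spd M"
  shows "spd (matrix_inv M)"
  unfolding spd_def
proof (intro conjI allI impI)
  let ?I = "matrix_inv M"
  \<comment> \<open>The form of the inverse is the form of \<open>M\<close> at the preimages;
    symmetry and positivity both follow from this.\<close>
  have eq: "(?I *v x) \<bullet> y = (M *v (?I *v x)) \<bullet> (?I *v y)" for x y
    using symmetric_dot[OF spd_symmetric[OF assms], of "?I *v x" "?I *v y"]
    by (simp add: spd_matrix_inv_vec[OF assms])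
  then show "transpose ?I = ?I"
    by (intro symmetric_dotI) (simp add: spd_matrix_inv_vec[OF assms])
  fix x :: "real^'a" assume "x \<noteq> 0"
  then have "?I *v x \<noteq> 0"
    using spd_matrix_inv_vec(1)[OF assms, of x] by auto
  from spd_pos[OF assms this] show "(?I *v x) \<bullet> x > 0"
    unfolding eq[of x x] .
qed

lemma congruence_dot: "((transpose L ** M ** L) *v x) \<bullet> y = (M *v (L *v x)) \<bullet> (L *v y)"
  for M :: "real^'n^'n" and L :: "real^'m^'n"
  by (simp add: matrix_vector_mul_assoc[symmetric] transpose_dot del: transpose_matrix_vector)

lemma spd_congruence:
  fixes L :: "real^'m^'n"
  assumes "spd M" "\<And>x. L *v x = 0 \<Longrightarrow> x = 0"
  shows "spd (transpose L ** M ** L)"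
proof -
  have "transpose (transpose L ** M ** L) = transpose L ** M ** L"
    using spd_symmetric[OF assms(1)] by (simp add: matrix_transpose_mul matrix_mul_assoc)
  with assms show ?thesis
    by (auto simp: spd_def congruence_dot)
qed

text \<open>Existence: rescale an orthonormal eigenbasis of \<open>M\<close> by the square roots of
  the eigenvalues. Uniqueness: any other root acts in the same way on each basis vector. This
  justifies the \<open>THE\<close> in \<open>inv_sqrt\<close>.\<close>

lemma spd_sqrt_exists:
  fixes M :: "real^'n^'n"
  assumes "spd M"
  shows "\<exists>!N. spd N \<and> N ** N = M"
proof -
  obtain B where orth: "pairwise orthogonal B"
    and B: "\<forall>b\<in>B. norm b = 1 \<and> (\<exists>m. M *v b = m *\<^sub>R b)" and spanB: "span B = UNIV"
    using selfadjoint_eigenbasis[of "(*v) M" UNIV] symmetric_dot[OF spd_symmetric[OF assms]]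
    by (metis matrix_vector_mul_linear subset_UNIV subspace_UNIV)
  then obtain l where l: "\<And>b. b \<in> B \<Longrightarrow> M *v b = l b *\<^sub>R b" by metis
  have "0 \<notin> B" using B by force
  then have finB: "finite B"
    using orth by (simp add: pairwise_orthogonal_independent finiteI_independent)
  have bb: "b \<bullet> b = 1" if "b \<in> B" for b using B that by (simp add: dot_square_norm)
  have lpos: "l b > 0" if "b \<in> B" for b
    using spd_pos[OF assms, of b] l[OF that] bb[OF that] by fastforce
  define f where "f x = (\<Sum>b\<in>B. (sqrt (l b) * (b \<bullet> x)) *\<^sub>R b)" for x
  have "linear f"
    unfolding f_def
    by (intro linear_compose_sum ballI linearI)
      (simp_all add: inner_add_right algebra_simps)
  define N where "N = matrix f"
  have N: "N *v x = f x" for x by (simp add: N_def matrix_works \<open>linear f\<close>)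
  have fdot: "f x \<bullet> y = (\<Sum>b\<in>B. sqrt (l b) * (b \<bullet> x) * (b \<bullet> y))" for x y
    by (simp add: f_def inner_sum_left mult.assoc)
  have fb: "f b = sqrt (l b) *\<^sub>R b" if "b \<in> B" for b
  proof -
    have "f b = (\<Sum>c\<in>B. if c = b then sqrt (l b) *\<^sub>R b else 0)"
      unfolding f_def
      using orth that bb by (intro sum.cong) (auto simp: pairwise_def orthogonal_def)
    then show ?thesis using that finB by simp
  qed
  show ?thesis
  proof (rule ex1I)
    have "spd N"
      unfolding spd_def
    proof (intro conjI allI impI)
      have "(f x) \<bullet> y = x \<bullet> f y" for x y
        unfolding inner_commute[of x "f y"] fdot by (rule sum.cong) simp_all
      then show "transpose N = N" by (intro symmetric_dotI) (simp add: N)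
      fix x :: "real^'n" assume "x \<noteq> 0"
      \<comment> \<open>Otherwise \<open>x\<close> would be orthogonal to the whole space, hence to
        itself.\<close>
      have "\<exists>b\<in>B. b \<bullet> x \<noteq> 0"
      proof (rule ccontr)
        assume "\<not> ?thesis"
        then have "orthogonal x b" if "b \<in> B" for b
          using that by (simp add: orthogonal_def inner_commute[of x])
        then have "orthogonal x x"
          using orthogonal_to_span[of x B x] spanB by blast
        with \<open>x \<noteq> 0\<close> show False by (simp add: orthogonal_def)
      qed
      then obtain b where b: "b \<in> B" "b \<bullet> x \<noteq> 0" by blast
      have "0 < f x \<bullet> x"
        unfolding fdot
      proof (rule sum_pos2[OF finB b(1)])
        show "0 < sqrt (l b) * (b \<bullet> x) * (b \<bullet> x)"
          using b lpos[of b] by (simp add: mult.assoc flip: power2_eq_square)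
        show "0 \<le> sqrt (l c) * (c \<bullet> x) * (c \<bullet> x)" if "c \<in> B" for c
          using lpos[OF that] by (simp add: mult.assoc flip: power2_eq_square)
      qed
      then show "0 < (N *v x) \<bullet> x" by (simp add: N)
    qed
    moreover have "N ** N = M"
    proof -
      have "(N ** N) *v x = M *v x" for x
      proof (rule linear_eq_on_span[of "(*v) (N ** N)" "(*v) M" B])
        show "(N ** N) *v b = M *v b" if "b \<in> B" for b
          using that lpos[OF that]
          by (simp add: matrix_vector_mul_assoc[symmetric] N fb l linear_scale[OF \<open>linear f\<close>])
      qed (auto simp: spanB)
      then show ?thesis by (simp add: matrix_eq)
    qed
    ultimately show "spd N \<and> N ** N = M" ..
    fix K assume K: "spd K \<and> K ** K = M"
    have "K *v x = N *v x" for x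
    proof (rule linear_eq_on_span[of "(*v) K" "(*v) N" B])
      fix b assume b: "b \<in> B"
      define s where "s = sqrt (l b)"
      have s: "s > 0" "s * s = l b" using lpos[OF b] by (auto simp: s_def)
      define w where "w = K *v b - s *\<^sub>R b"
      have "K *v (K *v b) = (s * s) *\<^sub>R b"
        using K l[OF b] s by (simp add: matrix_vector_mul_assoc)
      \<comment> \<open>\<open>(K + s)(K - s) b = 0\<close>, and \<open>K + s\<close> is positive definite.\<close>
      then have "K *v w = - s *\<^sub>R w"
        by (simp add: w_def matrix_vector_mult_diff_distrib matrix_vector_mult_scaleR
            scaleR_diff_right)
      then have "(K *v w) \<bullet> w = - s * (w \<bullet> w)" by simp
      moreover have "(K *v w) \<bullet> w \<ge> 0" using K spd_nonneg by blast
      ultimately have "s * (w \<bullet> w) \<le> 0" by linarith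
      then have "w \<bullet> w \<le> 0" using s by (simp add: mult_le_0_iff)
      then have "w = 0" by (metis inner_eq_zero_iff inner_ge_zero order_antisym)
      then show "K *v b = N *v b" by (simp add: w_def N fb[OF b] s_def)
    qed (auto simp: spanB)
    then show "K = N" by (simp add: matrix_eq)
  qed
qed

lemma inv_sqrt:
  assumes "spd M"
  shows "spd (inv_sqrt M)" "inv_sqrt M ** inv_sqrt M = matrix_inv M"
  using theI'[OF spd_sqrt_exists[OF spd_inv[OF assms]]] by (auto simp: inv_sqrt_def)

text \<open>The change of variables by \<open>inv_sqrt M\<close> turns the form of \<open>M\<close>
  into the Euclidean one; it will turn the numerator of \<open>mu\<close> into
  \<open>v \<bullet> v\<close>.\<close>

lemma inv_sqrt_whitens:
  assumes "spd M"
  shows "(M *v (inv_sqrt M *v v)) \<bullet> (inv_sqrt M *v v) = v \<bullet> v"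
proof -
  let ?N = "inv_sqrt M"
  have "?N ** (?N ** M) = mat 1"
    using inv_sqrt(2)[OF assms] spd_matrix_inv(2)[OF assms] by (simp add: matrix_mul_assoc)
  \<comment> \<open>A one-sided inverse of a square matrix is two-sided, so the factors may be
    rotated.\<close>
  then have "(?N ** M) ** ?N = mat 1" by (metis matrix_left_right_inverse)
  then have "?N *v (M *v (?N *v v)) = v"
    by (simp add: matrix_vector_mul_assoc matrix_mul_assoc)
  then show ?thesis
    using symmetric_dot[OF spd_symmetric[OF inv_sqrt(1)[OF assms]], of "M *v (?N *v v)" v] by simp
qed

section \<open>The optimal interpolation\<close>

locale interpolation =
  fixes A X :: "real^'n^'n" and R :: "real^'n^'c" and S :: "real^'s^'n"
  assumes card_eq: "CARD('n) = CARD('c) + CARD('s)"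
    and spdA: "spd A" and spdX: "spd X"
    and ex_interp: "\<exists>P :: real^'c^'n. R ** P = mat 1"
    and rankS: "rank S = CARD('s)"
    and RS: "R ** S = 0"
begin

abbreviation "W \<equiv> transpose S ** X ** S"
abbreviation "N \<equiv> inv_sqrt W"
abbreviation "AX \<equiv> A_X A X S"
abbreviation "BX \<equiv> B_X A X S"
abbreviation "form x y \<equiv> (A *v x) \<bullet> y"

text \<open>For an interpolation \<open>P\<close>, \<open>P *v coarse_coeff P z\<close> is the
  \<open>A\<close>-orthogonal projection of \<open>S *v z\<close> onto the range of
  \<open>P\<close>, and \<open>y = - coarse_coeff P z\<close> minimises the energy of
  \<open>P *v y + S *v z\<close>.\<close>

definition coarse_coeff :: "real^'c^'n \<Rightarrow> real^'s \<Rightarrow> real^'c" where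
  "coarse_coeff P z = matrix_inv (transpose P ** A ** P) *v ((transpose P ** A ** S) *v z)"

section \<open>Splitting vectors along the ranges of \<open>P\<close> and \<open>S\<close>\<close>

lemma S_ker: "S *v z = 0 \<Longrightarrow> z = 0"
proof -
  assume "S *v z = 0"
  then have "S *v z = S *v 0" by simp
  moreover have "inj ((*v) S)" using rankS by (simp add: full_rank_injective)
  ultimately show "z = 0" by (metis injD)
qed

lemma RS_vec: "R *v (S *v z) = 0"
  using RS by (simp add: matrix_vector_mul_assoc)

lemma RP_vec: "P \<in> interps R \<Longrightarrow> R *v (P *v y) = y"
  by (simp add: interps_def matrix_vector_mul_assoc)

lemma P_ker: "P \<in> interps R \<Longrightarrow> P *v y = 0 \<Longrightarrow> y = 0"
  using RP_vec[of P y] by simp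

lemma decomp_eq_0:
  assumes "P \<in> interps R" "P *v y + S *v z = 0"
  shows "y = 0" "z = 0"
proof -
  have "R *v (P *v y + S *v z) = y"
    by (simp add: matrix_vector_right_distrib RP_vec[OF assms(1)] RS_vec)
  with assms(2) show "y = 0" by simp
  with assms(2) show "z = 0" by (simp add: S_ker)
qed

text \<open>The map from \<open>(y, z)\<close> to \<open>P *v y + S *v z\<close> is injective, hence
  onto by the dimension count \<open>card_eq\<close>.\<close>

lemma interp_decomp:
  assumes "P \<in> interps R"
  obtains y z where "e = P *v y + S *v z"
proof -
  define T where "T p = P *v fst p + S *v snd p" for p
  have T: "linear T"
    by (rule linearI) (simp_all add: T_def matrix_vector_right_distrib matrix_vector_mult_scaleR
        scaleR_right_distrib)
  moreover have "inj T"
    unfolding linear_injective_0[OF T] using decomp_eq_0[OF assms] by (auto simp: T_def prod_eq_iff)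
  ultimately have "dim (range T) = DIM(real^'n)"
    by (simp add: dim_image_eq card_eq)
  then have "span (range T) = UNIV" by (rule dim_eq_full[THEN iffD1])
  moreover have "subspace (range T)" using T by (intro linear_subspace_image subspace_UNIV)
  ultimately have "e \<in> range T" by (metis UNIV_I span_eq_iff)
  then show ?thesis using that by (auto simp: T_def)
qed

lemma spdW: "spd W"
  using spdX S_ker by (rule spd_congruence)

lemma spdN: "spd N"
  by (rule inv_sqrt(1)[OF spdW])

lemma spdG: "P \<in> interps R \<Longrightarrow> spd (transpose P ** A ** P)"
  using spdA P_ker by (rule spd_congruence)

text \<open>\<open>I - P R\<close> projects onto the range of \<open>S\<close> along the range of
  \<open>P\<close>, so only \<open>z\<close> survives in the numerator.\<close>

lemma mu_decomp:
  assumes "P \<in> interps R"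
  shows "mu A X (P ** R) (P *v y + S *v z) =
    ((W *v z) \<bullet> z) / form (P *v y + S *v z) (P *v y + S *v z)"
proof -
  have "(mat 1 - P ** R) *v (P *v y + S *v z) = S *v z"
    by (simp add: matrix_vector_mult_diff_rdistrib matrix_vector_right_distrib
        matrix_vector_mul_assoc[symmetric] RP_vec[OF assms] RS_vec)
  then show ?thesis
    by (simp add: mu_def matrix_vector_mul_assoc[symmetric] congruence_dot transpose_dot
        del: transpose_matrix_vector)
qed

section \<open>The quadratic forms of \<open>AX\<close> and \<open>BX P\<close>\<close>

lemma A_X_dot: "(AX *v v) \<bullet> w = form (S *v (N *v v)) (S *v (N *v w))"
  using symmetric_dot[OF spd_symmetric[OF spdN]]
  by (simp add: A_X_def matrix_vector_mul_assoc[symmetric] transpose_dot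
      del: transpose_matrix_vector)

lemma B_X_vec:
  "BX P *v v = AX *v v - N *v ((transpose S ** A ** P) *v coarse_coeff P (N *v v))"
  by (simp add: A_X_def B_X_def coarse_coeff_def matrix_vector_mul_assoc[symmetric]
      matrix_vector_mult_diff_rdistrib matrix_vector_mult_diff_distrib
      del: transpose_matrix_vector)

lemma B_X_dot:
  "(BX P *v v) \<bullet> w = (AX *v v) \<bullet> w - form (P *v coarse_coeff P (N *v v)) (S *v (N *v w))"
  using symmetric_dot[OF spd_symmetric[OF spdN]]
  by (simp add: B_X_vec inner_diff_left matrix_vector_mul_assoc[symmetric] transpose_dot
      del: transpose_matrix_vector)

text \<open>Galerkin orthogonality: \<open>coarse_coeff P z\<close> solves the normal equations, so
  \<open>S *v z - P *v coarse_coeff P z\<close> is \<open>A\<close>-orthogonal to the range of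
  \<open>P\<close>.\<close>

lemma coarse_form:
  assumes "P \<in> interps R"
  shows "form (P *v y) (P *v coarse_coeff P z) = form (P *v y) (S *v z)"
proof -
  let ?G = "transpose P ** A ** P"
  have "form (P *v y) (P *v coarse_coeff P z) = (?G *v y) \<bullet> coarse_coeff P z"
    by (simp add: congruence_dot)
  also have "\<dots> = y \<bullet> (?G *v coarse_coeff P z)"
    by (rule symmetric_dot[OF spd_symmetric[OF spdG[OF assms]]])
  also have "\<dots> = y \<bullet> (transpose P *v (A *v (S *v z)))"
    unfolding coarse_coeff_def spd_matrix_inv_vec(1)[OF spdG[OF assms]]
    by (simp add: matrix_vector_mul_assoc matrix_mul_assoc del: transpose_matrix_vector)
  also have "\<dots> = (P *v y) \<bullet> (A *v (S *v z))"
    by (metis inner_commute transpose_dot)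
  also have "\<dots> = form (P *v y) (S *v z)"
    by (rule symmetric_dot[OF spd_symmetric[OF spdA], symmetric])
  finally show ?thesis .
qed

lemma form_sym: "form x y = form y x"
  by (metis inner_commute symmetric_dot[OF spd_symmetric[OF spdA]])

text \<open>The loss from \<open>AX\<close> to \<open>BX P\<close> is the energy of a projected
  vector: it is nonnegative, and zero only if the coarse coefficient vanishes.\<close>

lemma B_X_quad:
  assumes "P \<in> interps R"
  shows "(BX P *v v) \<bullet> v = (AX *v v) \<bullet> v -
    form (P *v coarse_coeff P (N *v v)) (P *v coarse_coeff P (N *v v))"
  by (simp add: B_X_dot coarse_form[OF assms])

text \<open>Completing the square in the coarse variable \<open>y\<close>.\<close>

lemma form_decomp:
  assumes "P \<in> interps R"
  shows "form (P *v y + S *v (N *v v)) (P *v y + S *v (N *v v)) = (BX P *v v) \<bullet> v +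
    form (P *v (y + coarse_coeff P (N *v v))) (P *v (y + coarse_coeff P (N *v v)))"
  by (simp add: B_X_quad[OF assms] A_X_dot matrix_vector_right_distrib inner_add_left
      inner_add_right coarse_form[OF assms] form_sym[of "S *v (N *v v)" "P *v y"]
      form_sym[of "P *v coarse_coeff P (N *v v)" "P *v y"])

lemma A_X_symmetric: "transpose AX = AX"
  by (rule symmetric_dotI) (metis A_X_dot form_sym inner_commute)

lemma B_X_symmetric:
  assumes "P \<in> interps R"
  shows "transpose (BX P) = BX P"
proof (rule symmetric_dotI)
  fix v w
  show "(BX P *v v) \<bullet> w = v \<bullet> (BX P *v w)"
    \<comment> \<open>The correction becomes the \<open>A\<close>-form of two projected vectors,
      which is visibly symmetric.\<close>
    unfolding inner_commute[of v] B_X_dot coarse_form[OF assms, symmetric]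
    using A_X_dot form_sym by metis
qed

text \<open>At the minimising \<open>y\<close> the square in \<open>form_decomp\<close> vanishes, so
  the value is the energy of a vector with nonzero \<open>S\<close> component.\<close>

lemma B_X_pos:
  assumes "P \<in> interps R" "v \<noteq> 0"
  shows "(BX P *v v) \<bullet> v > 0"
proof -
  let ?e = "P *v (- coarse_coeff P (N *v v)) + S *v (N *v v)"
  have "N *v v \<noteq> 0" using spd_ker[OF spdN] assms(2) by blast
  then have "?e \<noteq> 0" using decomp_eq_0(2)[OF assms(1)] by blast
  then have "form ?e ?e > 0" by (rule spd_pos[OF spdA])
  then show ?thesis by (simp add: form_decomp[OF assms(1)])
qed

section \<open>The maximum of \<open>mu\<close>\<close>

lemma N_surj: obtains v where "z = N *v v"
  using spd_matrix_inv_vec(1)[OF spdN, of z] by metis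

text \<open>With \<open>z = N *v w\<close> and \<open>w \<noteq> 0\<close>, \<open>mu\<close> is at
  most the reciprocal Rayleigh quotient of \<open>BX P\<close> at \<open>w\<close>, with equality at
  the minimising \<open>y\<close>.\<close>

lemma mu_max_eq:
  assumes P: "P \<in> interps R"
  shows "lambda_min (BX P) > 0" "mu_max A X (P ** R) = 1 / lambda_min (BX P)"
proof -
  let ?l = "lambda_min (BX P)"
  obtain v where v: "v \<noteq> 0" "BX P *v v = ?l *\<^sub>R v"
    using lambda_min_symmetric(1)[OF B_X_symmetric[OF P]] by (auto simp: eigenvecs_def)
  have "0 < ?l * (v \<bullet> v)" using B_X_pos[OF P v(1)] v(2) by simp
  then show l: "?l > 0" using v(1) by (metis inner_gt_zero_iff zero_less_mult_pos2)
  show "mu_max A X (P ** R) = 1 / ?l"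
    unfolding mu_max_def
  proof (rule Greatest_equality)
    \<comment> \<open>The maximiser: a minimal eigenvector \<open>v\<close>, paired with the
      \<open>y\<close> that cancels the square in \<open>form_decomp\<close>.\<close>
    let ?e = "P *v (- coarse_coeff P (N *v v)) + S *v (N *v v)"
    have "N *v v \<noteq> 0" using spd_ker[OF spdN] v(1) by blast
    then have "?e \<noteq> 0" using decomp_eq_0(2)[OF P] by blast
    moreover have "mu A X (P ** R) ?e = 1 / ?l"
      unfolding mu_decomp[OF P] form_decomp[OF P] inv_sqrt_whitens[OF spdW]
      using v by simp
    ultimately show "\<exists>e. e \<noteq> 0 \<and> 1 / ?l = mu A X (P ** R) e" by metis
  next
    fix m assume "\<exists>e. e \<noteq> 0 \<and> m = mu A X (P ** R) e"
    then obtain e where e: "e \<noteq> 0" "m = mu A X (P ** R) e" by blast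
    obtain y z where yz: "e = P *v y + S *v z" by (rule interp_decomp[OF P])
    obtain w where w: "z = N *v w" by (rule N_surj)
    have m: "m = (w \<bullet> w) / form e e"
      unfolding e(2) yz w mu_decomp[OF P] inv_sqrt_whitens[OF spdW] ..
    have "?l * (w \<bullet> w) \<le> (BX P *v w) \<bullet> w"
      by (rule lambda_min_symmetric(2)[OF B_X_symmetric[OF P]])
    also have "\<dots> \<le> form e e"
      unfolding yz w form_decomp[OF P] by (simp add: spd_nonneg[OF spdA])
    finally show "m \<le> 1 / ?l"
      using l spd_pos[OF spdA e(1)] by (simp add: m field_simps)
  qed
qed

section \<open>Comparison with \<open>AX\<close> and the ideal interpolations\<close>

lemma lambda_min_B_X_le:
  assumes P: "P \<in> interps R"
  shows "lambda_min (BX P) \<le> lambda_min AX"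
proof -
  obtain v where v: "v \<noteq> 0" "AX *v v = lambda_min AX *\<^sub>R v"
    using lambda_min_symmetric(1)[OF A_X_symmetric] by (auto simp: eigenvecs_def)
  \<comment> \<open>The Rayleigh bound for \<open>BX P\<close> is tested at a minimal eigenvector of
    \<open>AX\<close>.\<close>
  have "lambda_min (BX P) * (v \<bullet> v) \<le> (BX P *v v) \<bullet> v"
    by (rule lambda_min_symmetric(2)[OF B_X_symmetric[OF P]])
  also have "\<dots> \<le> (AX *v v) \<bullet> v"
    by (simp add: B_X_quad[OF P] spd_nonneg[OF spdA])
  also have "\<dots> = lambda_min AX * (v \<bullet> v)" using v by simp
  finally show ?thesis using v(1) by (simp add: mult_le_cancel_right)
qed

lemma B_X_eq_A_X:
  fixes P :: "real^'c^'n"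
  assumes "(transpose P ** A ** S) *v (N *v v) = 0"
  shows "BX P *v v = AX *v v"
  by (simp add: B_X_vec coarse_coeff_def assms)

text \<open>Provides an interpolation attaining equality in \<open>lambda_min_B_X_le\<close>. For
  the \<open>P\<close> chosen here, \<open>transpose P ** A\<close> is a left multiple of
  \<open>R\<close>, which annihilates \<open>S\<close>.\<close>

lemma P_0_nonempty: "P_0 A R S \<noteq> {}"
proof -
  obtain P' where P': "R ** P' = mat 1" using ex_interp by blast
  \<comment> \<open>The double transpose gives \<open>?H\<close> the shape required by
    \<open>spd_congruence\<close>, with \<open>transpose R\<close> in the role of
    \<open>L\<close>.\<close>
  let ?Ai = "matrix_inv A" and ?H = "transpose (transpose R) ** matrix_inv A ** transpose R"
  have "transpose P' ** transpose R = mat 1"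
    using P' by (metis matrix_transpose_mul transpose_mat)
  then have inj: "x = 0" if "transpose R *v x = 0" for x
    using that by (metis matrix_vector_mul_assoc matrix_vector_mul_lid matrix_vector_mult_0_right)
  have H: "spd ?H" by (rule spd_congruence[OF spd_inv[OF spdA] inj])
  define P where "P = ?Ai ** transpose R ** matrix_inv ?H"
  have "R ** P = ?H ** matrix_inv ?H" by (simp add: P_def matrix_mul_assoc)
  then have "P \<in> interps R" using spd_matrix_inv(1)[OF H] by (simp add: interps_def)
  moreover have "transpose P ** A ** S = 0"
  proof -
    have "transpose P ** A = transpose (matrix_inv ?H) ** R ** (?Ai ** A)"
      using spd_symmetric[OF spd_inv[OF spdA]]
      by (simp add: P_def matrix_transpose_mul matrix_mul_assoc)
    then have "transpose P ** A ** S = transpose (matrix_inv ?H) ** (R ** S)"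
      by (simp add: spd_matrix_inv(2)[OF spdA] matrix_mul_assoc)
    then show ?thesis by (simp add: RS)
  qed
  ultimately show ?thesis by (auto simp: P_0_def)
qed

text \<open>The null space is everything, so any minimal eigenvector of \<open>BX P\<close> is a
  witness.\<close>

lemma P_0_subset_P_2: "P_0 A R S \<subseteq> P_2 A X R S"
proof
  fix P assume "P \<in> P_0 A R S"
  then have P: "P \<in> interps R" "transpose P ** A ** S = 0" by (auto simp: P_0_def)
  then show "P \<in> P_2 A X R S"
    using lambda_min_symmetric(1)[OF B_X_symmetric[OF P(1)]]
    by (auto simp: P_2_def null_space_def)
qed

text \<open>Both matrices agree at the witness \<open>v\<close>, so testing the Rayleigh bound for
  \<open>AX\<close> there gives the inequality opposite to \<open>lambda_min_B_X_le\<close>.\<close>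

lemma lambda_min_P_2:
  assumes "P \<in> P_2 A X R S"
  shows "lambda_min (BX P) = lambda_min AX"
proof (rule antisym)
  have P: "P \<in> interps R" using assms by (simp add: P_2_def)
  then show "lambda_min (BX P) \<le> lambda_min AX" by (rule lambda_min_B_X_le)
  obtain v where v: "(transpose P ** A ** S) *v (N *v v) = 0" "v \<noteq> 0"
    "BX P *v v = lambda_min (BX P) *\<^sub>R v"
    using assms by (auto simp: P_2_def null_space_def eigenvecs_def matrix_vector_mul_assoc)
  have "lambda_min AX * (v \<bullet> v) \<le> (AX *v v) \<bullet> v"
    by (rule lambda_min_symmetric(2)[OF A_X_symmetric])
  also have "\<dots> = lambda_min (BX P) * (v \<bullet> v)"
    using v by (simp add: B_X_eq_A_X)
  finally show "lambda_min AX \<le> lambda_min (BX P)"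
    using v(2) by (simp add: mult_le_cancel_right)
qed

text \<open>Any member of \<open>P_0\<close> attains this value, and
  \<open>lambda_min_B_X_le\<close> shows that it is a lower bound.\<close>

lemma mu_star_eq: "mu_star A X R = 1 / lambda_min AX"
  unfolding mu_star_def
proof (rule Least_equality)
  obtain P where P: "P \<in> P_0 A R S" using P_0_nonempty by blast
  then have "P \<in> interps R" "lambda_min (BX P) = lambda_min AX"
    using P_0_subset_P_2 lambda_min_P_2 by (auto simp: P_0_def)
  then show "\<exists>P\<in>interps R. 1 / lambda_min AX = mu_max A X (P ** R)"
    using mu_max_eq(2) by metis
next
  fix m assume "\<exists>P\<in>interps R. m = mu_max A X (P ** R)"
  then obtain P where "P \<in> interps R" "m = mu_max A X (P ** R)" by blast
  then show "1 / lambda_min AX \<le> m"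
    using mu_max_eq lambda_min_B_X_le by (simp add: frac_le)
qed

lemma P_star_iff:
  "P \<in> P_star A X R \<longleftrightarrow> P \<in> interps R \<and> lambda_min (BX P) = lambda_min AX"
  by (auto simp: P_star_def mu_star_eq mu_max_eq)

text \<open>A single vector serves as witness for both \<open>P_1\<close> and
  \<open>P_2\<close>.\<close>

lemma P_star_common_eigenvector:
  assumes "P \<in> P_star A X R"
  obtains v where "(transpose P ** A ** S) *v (N *v v) = 0" "v \<noteq> 0"
    "AX *v v = lambda_min AX *\<^sub>R v" "BX P *v v = lambda_min (BX P) *\<^sub>R v"
proof -
  have P: "P \<in> interps R" and eq: "lambda_min (BX P) = lambda_min AX"
    using assms by (auto simp: P_star_iff)
  obtain v where v: "v \<noteq> 0" "AX *v v = lambda_min AX *\<^sub>R v"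
    using lambda_min_symmetric(1)[OF A_X_symmetric] by (auto simp: eigenvecs_def)
  let ?c = "coarse_coeff P (N *v v)"
  have "lambda_min AX * (v \<bullet> v) \<le> (BX P *v v) \<bullet> v"
    using lambda_min_symmetric(2)[OF B_X_symmetric[OF P], of v] eq by simp
  also have "\<dots> = lambda_min AX * (v \<bullet> v) - form (P *v ?c) (P *v ?c)"
    using v by (simp add: B_X_quad[OF P])
  finally have "P *v ?c = 0"
    using spd_pos[OF spdA, of "P *v ?c"] by force
  then have "?c = 0" by (rule P_ker[OF P])
  \<comment> \<open>The inverse of \<open>transpose P ** A ** P\<close> is definite, so it has
    trivial kernel and can be stripped from \<open>?c = 0\<close>.\<close>
  then have null: "(transpose P ** A ** S) *v (N *v v) = 0"
    unfolding coarse_coeff_def by (rule spd_ker[OF spd_inv[OF spdG[OF P]]])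
  with v eq show ?thesis by (intro that) (auto simp: B_X_eq_A_X)
qed

lemma P_2_eq_P_star: "P_2 A X R S = P_star A X R"
proof
  show "P_2 A X R S \<subseteq> P_star A X R"
  proof
    fix P assume "P \<in> P_2 A X R S"
    then show "P \<in> P_star A X R"
      using lambda_min_P_2[of P] by (simp add: P_star_iff) (simp add: P_2_def)
  qed
  show "P_star A X R \<subseteq> P_2 A X R S"
  proof
    fix P assume P: "P \<in> P_star A X R"
    then obtain v where "(transpose P ** A ** S) *v (N *v v) = 0" "v \<noteq> 0"
      "BX P *v v = lambda_min (BX P) *\<^sub>R v"
      by (rule P_star_common_eigenvector)
    with P show "P \<in> P_2 A X R S"
      by (auto simp: P_2_def P_star_def null_space_def eigenvecs_def
          matrix_vector_mul_assoc[symmetric])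
  qed
qed

lemma P_star_subset_P_1: "P_star A X R \<subseteq> P_1 A X R S"
proof
  fix P assume P: "P \<in> P_star A X R"
  then obtain v where "(transpose P ** A ** S) *v (N *v v) = 0" "v \<noteq> 0"
    "AX *v v = lambda_min AX *\<^sub>R v"
    by (rule P_star_common_eigenvector)
  with P show "P \<in> P_1 A X R S"
    by (auto simp: P_1_def P_star_def null_space_def eigenvecs_def
        matrix_vector_mul_assoc[symmetric])
qed

end

theorem theorem3p1:
  fixes A X :: "real^'n^'n"
    and R :: "real^'n^'c"
    and S :: "real^'s^'n"
  assumes "CARD('n) = CARD('c) + CARD('s)"
    and "spd A"
    and "spd X"
    and "\<exists>P :: real^'c^'n. R ** P = mat 1"
    and "rank S = CARD('s)"
    and "R ** S = 0"
  shows "P_0 A R S \<subseteq> P_2 A X R S \<and> P_2 A X R S = P_star A X R \<and> P_star A X R \<subseteq> P_1 A X R S"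
proof -
  interpret interpolation A X R S
    using assms by unfold_locales
  show ?thesis
    using P_0_subset_P_2 P_2_eq_P_star P_star_subset_P_1 by blast
qed

end
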